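(* There are three different angles $\theta_1,\theta_2,\theta_3\in[0,2\pi)$ such that at all points of the set $$M_{\mathrm{reg}}:=\Bigl\{(\cos\theta,\sin\theta,r)\mid \theta\in[0,2\pi)\setminus\{\theta_1,\theta_2,\theta_3\},\ r\in(0,\infty)\Bigr\}$$ the surface $\mathrm{FC}=F(\mathrm{Cyl}\cap\Pi^+)$ is smooth.
   Context: Let $\Pi^0=\{(p,q,0)\}\subset\mathbb{R}^3$ and $\Pi^+=\{(p,q,r)\in\mathbb{R}^3\mid r>0\}$. $ABC$ is a non-degenerate triangle in $\Pi^0$ whose circumscribed circle $S$ has radius $1$ and center at the origin $O=(0,0,0)$; coordinates are chosen so that $A=(1,0,0)$. $\mathrm{Cyl}=S\times(-\infty,\infty)$. For $D\in\Pi^+$, $F(D)=(\cos\angle BDC,\cos\angle ADC,\cos\angle ADB)$. The surface $\mathrm{FC}=F(\mathrm{Cyl}\cap\Pi^+)$ is regarded as the parametrized surface $(\theta,r)\mapsto F(\cos\theta,\sin\theta,r)$, $r>0$; it is smooth at a point $(\cos\theta,\sin\theta,r)$ of $\mathrm{Cyl}\cap\Pi^+$ if the two partial derivatives of this parametrization are linearly independent there. *)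

theory Defs
  imports "HOL-Analysis.Analysis"
begin

definition Pi_zero :: "(real^3) set" where
  "Pi_zero = {D. D $ 3 = 0}"

definition Pi_plus :: "(real^3) set" where
  "Pi_plus = {D. D $ 3 > 0}"

definition unit_circle :: "(real^3) set" where
  "unit_circle = {P \<in> Pi_zero. dist 0 P = 1}"

definition Cyl :: "(real^3) set" where
  "Cyl = {D. vector [D $ 1, D $ 2, 0] \<in> unit_circle}"

(* The angle XDY at the vertex D, meaningful for X \<noteq> D and Y \<noteq> D. *)
definition angle_at :: "real^3 \<Rightarrow> real^3 \<Rightarrow> real^3 \<Rightarrow> real" where
  "angle_at X D Y = arccos (((X - D) \<bullet> (Y - D)) / (norm (X - D) * norm (Y - D)))"

definition F :: "real^3 \<Rightarrow> real^3 \<Rightarrow> real^3 \<Rightarrow> real^3 \<Rightarrow> real^3" where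
  "F A B C D = vector [cos (angle_at B D C), cos (angle_at A D C), cos (angle_at A D B)]"

definition cyl_point :: "real \<Rightarrow> real \<Rightarrow> real^3" where
  "cyl_point \<theta> r = vector [cos \<theta>, sin \<theta>, r]"

definition FC_param :: "real^3 \<Rightarrow> real^3 \<Rightarrow> real^3 \<Rightarrow> real \<Rightarrow> real \<Rightarrow> real^3" where
  "FC_param A B C \<theta> r = F A B C (cyl_point \<theta> r)"

(* The condition u \<noteq> v is needed because independent {u, v} is about the set
   {u, v}, which is independent for u = v \<noteq> 0. *)
definition regular_param_at :: "(real \<Rightarrow> real \<Rightarrow> real^3) \<Rightarrow> real \<Rightarrow> real \<Rightarrow> bool" where
  "regular_param_at X \<theta> r \<longleftrightarrow>
    (\<exists>u v. ((\<lambda>t. X t r) has_vector_derivative u) (at \<theta>) \<and>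
           ((\<lambda>s. X \<theta> s) has_vector_derivative v) (at r) \<and>
           u \<noteq> v \<and> independent {u, v})"

(* The parameter \<theta> of a point D of Cyl is unique up to multiples of 2 * pi. *)
definition FC_smooth_at :: "real^3 \<Rightarrow> real^3 \<Rightarrow> real^3 \<Rightarrow> real^3 \<Rightarrow> bool" where
  "FC_smooth_at A B C D \<longleftrightarrow>
    D \<in> Cyl \<inter> Pi_plus \<and>
    (\<forall>\<theta> r. D = cyl_point \<theta> r \<longrightarrow> regular_param_at (FC_param A B C) \<theta> r)"

definition M_reg :: "real \<Rightarrow> real \<Rightarrow> real \<Rightarrow> (real^3) set" where
  "M_reg \<theta>1 \<theta>2 \<theta>3 =
    {cyl_point \<theta> r |\<theta> r. \<theta> \<in> {0..<2 * pi} - {\<theta>1, \<theta>2, \<theta>3} \<and> r \<in> {0<..}}"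

end

theory Submission
  imports Defs
begin

text \<open>
  Write \<open>s\<^sub>i = sin h\<^sub>i\<close>, \<open>c\<^sub>i = cos h\<^sub>i\<close>, where \<open>h\<^sub>i\<close> is half the difference between \<open>\<theta>\<close> and the
  angle of the i-th vertex. By the law of cosines, a tangent vector \<open>(t, \<rho>)\<close> of the parameter
  domain lies in the kernel of the derivative iff the numbers
  \<open>s\<^sub>i (2 s\<^sub>i c\<^sub>i t + r \<rho>) / (4 s\<^sub>i\<^sup>2 + r\<^sup>2)\<close> are proportional to the \<open>c\<^sub>i\<close>. With a factor of
  proportionality \<open>k\<close>, this says that a binary cubic form, with equal coefficients at \<open>s\<^sup>3\<close> and
  \<open>s c\<^sup>2\<close>, vanishes at the three distinct points \<open>(s\<^sub>i : c\<^sub>i)\<close> of the projective line. Such a form is a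
  multiple of the product of the \<open>s c\<^sub>i - s\<^sub>i c\<close>, whose coefficients at \<open>s\<^sup>3\<close> and \<open>s c\<^sup>2\<close> differ by
  \<open>cos (h\<^sub>1 + h\<^sub>2 + h\<^sub>3)\<close>. Hence the form, and with it \<open>(t, \<rho>)\<close>, is zero unless this cosine
  vanishes, which happens for exactly three values of \<open>\<theta>\<close>.
\<close>

section \<open>Linear algebra of binary cubic forms with three given zeros\<close>

lemma homogeneous_system_3:
  fixes x y z :: "'a::idom"
  assumes "a1 * x + b1 * y + e1 * z = 0" and "a2 * x + b2 * y + e2 * z = 0"
    and "a3 * x + b3 * y + e3 * z = 0"
    and det: "a1 * (b2 * e3 - b3 * e2) - a2 * (b1 * e3 - b3 * e1) + a3 * (b1 * e2 - b2 * e1) \<noteq> 0"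
  shows "x = 0 \<and> y = 0 \<and> z = 0"
proof -
  let ?d = "a1 * (b2 * e3 - b3 * e2) - a2 * (b1 * e3 - b3 * e1) + a3 * (b1 * e2 - b2 * e1)"
  \<comment> \<open>Cramer's rule without division: the multipliers are the cofactors of the column
    of \<open>x\<close>, so \<open>y\<close> and \<open>z\<close> cancel. The other two unknowns are
    treated alike.\<close>
  have "?d * x = (b2 * e3 - b3 * e2) * (a1 * x + b1 * y + e1 * z)
      - (b1 * e3 - b3 * e1) * (a2 * x + b2 * y + e2 * z) + (b1 * e2 - b2 * e1) * (a3 * x + b3 * y + e3 * z)"
    by (simp add: algebra_simps)
  moreover have "?d * y = (a3 * e2 - a2 * e3) * (a1 * x + b1 * y + e1 * z)
      - (a3 * e1 - a1 * e3) * (a2 * x + b2 * y + e2 * z) + (a2 * e1 - a1 * e2) * (a3 * x + b3 * y + e3 * z)"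
    by (simp add: algebra_simps)
  moreover have "?d * z = (a2 * b3 - a3 * b2) * (a1 * x + b1 * y + e1 * z)
      - (a1 * b3 - a3 * b1) * (a2 * x + b2 * y + e2 * z) + (a1 * b2 - a2 * b1) * (a3 * x + b3 * y + e3 * z)"
    by (simp add: algebra_simps)
  ultimately have "?d * x = 0" "?d * y = 0" "?d * z = 0"
    unfolding assms(1-3) by simp_all
  with det show ?thesis by simp
qed

text \<open>The determinant of the system vanishes when two of the points \<open>(s1 : c1)\<close>,
  \<open>(s2 : c2)\<close>, \<open>(s3 : c3)\<close> coincide, so the three 2x2 minors divide it.
  The remaining trilinear factor is, for sines and cosines, the expanded cosine of the sum of three
  angles.\<close>

lemma cubic_form_zero:
  fixes s1 s2 s3 c1 c2 c3 R T K :: real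
  assumes "s1 * (s1^2 + c1^2) * R + s1^2 * c1 * T + c1^3 * K = 0"
    and "s2 * (s2^2 + c2^2) * R + s2^2 * c2 * T + c2^3 * K = 0"
    and "s3 * (s3^2 + c3^2) * R + s3^2 * c3 * T + c3^3 * K = 0"
    and "s1 * c2 - c1 * s2 \<noteq> 0" and "s1 * c3 - c1 * s3 \<noteq> 0" and "s2 * c3 - c2 * s3 \<noteq> 0"
    and "c1 * c2 * c3 - s1 * s2 * c3 - s1 * c2 * s3 - c1 * s2 * s3 \<noteq> 0"
  shows "R = 0 \<and> T = 0 \<and> K = 0"
proof (rule homogeneous_system_3[OF assms(1-3)])
  have "s1 * (s1^2 + c1^2) * (s2^2 * c2 * c3^3 - s3^2 * c3 * c2^3)
      - s2 * (s2^2 + c2^2) * (s1^2 * c1 * c3^3 - s3^2 * c3 * c1^3)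
      + s3 * (s3^2 + c3^2) * (s1^2 * c1 * c2^3 - s2^2 * c2 * c1^3)
    = - (s1 * c2 - c1 * s2) * (s1 * c3 - c1 * s3) * (s2 * c3 - c2 * s3)
      * (c1 * c2 * c3 - s1 * s2 * c3 - s1 * c2 * s3 - c1 * s2 * s3)" (is "?det = _")
    by (simp add: algebra_simps power2_eq_square power3_eq_cube)
  then show "?det \<noteq> 0" using assms(4-7) by simp
qed

section \<open>Derivatives of law-of-cosines quotients, and linear independence\<close>

lemma DERIV_cosine_rule_quotient:
  fixes f g :: "real \<Rightarrow> real"
  assumes "(f has_real_derivative f') (at x)" and "(g has_real_derivative g') (at x)"
    and "f x > 0" and "g x > 0"
  shows "((\<lambda>t. (f t + g t - K) / (2 * sqrt (f t * g t))) has_real_derivative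
    (f' * g x * (f x - g x + K) + g' * f x * (g x - f x + K)) / (4 * sqrt (f x * g x)^3)) (at x)"
proof -
  have pos: "f x * g x > 0" using assms by simp
  define S where "S = sqrt (f x * g x)"
  have S: "S > 0" "S^2 = f x * g x" using pos unfolding S_def by simp_all
  have "((\<lambda>t. (f t + g t - K) / (2 * sqrt (f t * g t))) has_real_derivative
     ((f' + g') * (2 * S) - (f x + g x - K) * (2 * ((f' * g x + g' * f x) * (inverse S / 2)))) / ((2 * S) * (2 * S))) (at x)"
  proof -
    have N: "((\<lambda>t. f t + g t - K) has_real_derivative f' + g') (at x)"
      using DERIV_diff[OF DERIV_add[OF assms(1,2)] DERIV_const[of K]] by simp
    have "((\<lambda>t. sqrt (f t * g t)) has_real_derivative inverse S / 2 * (f' * g x + g' * f x)) (at x)"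
      unfolding S_def by (rule DERIV_chain2[OF DERIV_real_sqrt[OF pos] DERIV_mult[OF assms(1,2)]])
    from DERIV_cmult[OF this, of 2]
    have "((\<lambda>t. 2 * sqrt (f t * g t)) has_real_derivative 2 * ((f' * g x + g' * f x) * (inverse S / 2))) (at x)"
      by (simp only: mult.commute)
    moreover have "2 * sqrt (f x * g x) \<noteq> 0" using assms(3,4) by simp
    ultimately show ?thesis unfolding S_def by (rule DERIV_divide[OF N])
  qed
  moreover have "(a * (2 * S) - b * (2 * (c * (inverse S / 2)))) / ((2 * S) * (2 * S))
    = (2 * a * S^2 - b * c) / (4 * S^3)" for a b c
    using S(1) by (simp add: divide_simps power2_eq_square power3_eq_cube)
  \<comment> \<open>With \<open>f\<close>, \<open>g\<close> the squares of the adjacent sides and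
    \<open>K\<close> that of the opposite side, the quotient is a cosine. Grouping by
    \<open>f'\<close> and \<open>g'\<close> isolates the two factors that
    \<open>sq_dist_diff\<close> turns into products.\<close>
  moreover have "2 * (f' + g') * S^2 - (f x + g x - K) * (f' * g x + g' * f x)
    = f' * g x * (f x - g x + K) + g' * f x * (g x - f x + K)"
    unfolding S(2) by (simp add: algebra_simps)
  ultimately show ?thesis unfolding S_def by simp
qed

lemma has_vector_derivative_vector_3:
  assumes "(f has_real_derivative f') (at x)" and "(g has_real_derivative g') (at x)"
    and "(h has_real_derivative h') (at x)"
  shows "((\<lambda>t. vector [f t, g t, h t] :: real^3) has_vector_derivative vector [f', g', h']) (at x)"
proof -
  have eq: "(vector [a, b, c] :: real^3) = a *\<^sub>R axis 1 1 + b *\<^sub>R axis 2 1 + c *\<^sub>R axis 3 1" for a b c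
    by (simp add: vec_eq_iff forall_3 axis_def)
  show ?thesis unfolding eq
    by (rule derivative_eq_intros assms refl | simp)+
qed

lemma independent_pairI:
  fixes u v :: "'a::real_vector"
  assumes "\<And>a b. a *\<^sub>R u + b *\<^sub>R v = 0 \<Longrightarrow> a = 0 \<and> b = 0"
  shows "u \<noteq> v \<and> independent {u, v}"
proof
  show "u \<noteq> v" using assms[of 1 "-1"] by auto
  then show "independent {u, v}"
    using assms by (auto simp: dependent_finite)
qed

section \<open>Angles and squared distances on the cylinder\<close>

lemma cos_angle_at:
  "cos (angle_at X D Y) = ((X - D) \<bullet> (Y - D)) / (norm (X - D) * norm (Y - D))"
proof -
  \<comment> \<open>Cauchy-Schwarz keeps the quotient in the domain of \<open>arccos\<close>; for
    \<open>X = D\<close> or \<open>Y = D\<close> it is \<open>0\<close> by the convention on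
    division by zero.\<close>
  have "\<bar>((X - D) \<bullet> (Y - D)) / (norm (X - D) * norm (Y - D))\<bar> \<le> 1"
    using Cauchy_Schwarz_ineq2[of "X - D" "Y - D"] by (auto simp: divide_le_eq_1)
  then show ?thesis unfolding angle_at_def by (simp add: cos_arccos_abs)
qed

text \<open>The squared distance from the circle point at angle \<beta> to
  \<open>cyl_point \<theta> r\<close>, in half-angle form.\<close>

definition sq_dist :: "real \<Rightarrow> real \<Rightarrow> real \<Rightarrow> real" where
  "sq_dist \<beta> \<theta> r = 4 * sin ((\<theta> - \<beta>) / 2)^2 + r^2"

lemma sq_chord: "(cos x - cos y)^2 + (sin x - sin y)^2 = 4 * sin ((y - x) / 2)^2" for x y :: real
proof -
  have "cos (y - x) = 1 - 2 * sin ((y - x) / 2)^2"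
    using cos_double_sin[of "(y - x) / 2"] by (simp only: mult_2 field_sum_of_halves)
  moreover have "(cos x - cos y)^2 + (sin x - sin y)^2 = 2 - 2 * cos (y - x)"
    using sin_cos_squared_add[of x] sin_cos_squared_add[of y]
    unfolding cos_diff by (simp add: power2_eq_square algebra_simps)
  ultimately show ?thesis by simp
qed

lemma norm_diff_cyl_point:
  "norm (cyl_point \<beta> 0 - cyl_point \<theta> r) ^ 2 = sq_dist \<beta> \<theta> r"
  unfolding power2_norm_eq_inner sq_dist_def sq_chord[of \<beta> \<theta>, symmetric]
  by (simp add: inner_vec_def sum_3 cyl_point_def power2_eq_square)

lemma cos_angle_at_cyl_point:
  assumes "r > 0"
  shows "cos (angle_at (cyl_point \<beta> 0) (cyl_point \<theta> r) (cyl_point \<gamma> 0)) =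
    (sq_dist \<beta> \<theta> r + sq_dist \<gamma> \<theta> r - 4 * sin ((\<gamma> - \<beta>) / 2)^2)
      / (2 * sqrt (sq_dist \<beta> \<theta> r * sq_dist \<gamma> \<theta> r))"
proof -
  let ?B = "cyl_point \<beta> 0" and ?C = "cyl_point \<gamma> 0" and ?D = "cyl_point \<theta> r"
  \<comment> \<open>The chord is the case of height \<open>0\<close> of the distance formula; it
    enters the law of cosines at \<open>?D\<close>.\<close>
  have "norm (?B - ?C)^2 = 4 * sin ((\<gamma> - \<beta>) / 2)^2"
    using norm_diff_cyl_point[of \<beta> \<gamma> 0] by (simp add: sq_dist_def)
  moreover have "norm (?B - ?C)^2 = norm (?B - ?D)^2 + norm (?C - ?D)^2 - 2 * ((?B - ?D) \<bullet> (?C - ?D))"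
    by (simp add: power2_norm_eq_inner inner_diff_left inner_diff_right inner_commute)
  ultimately have "2 * ((?B - ?D) \<bullet> (?C - ?D)) =
      sq_dist \<beta> \<theta> r + sq_dist \<gamma> \<theta> r - 4 * sin ((\<gamma> - \<beta>) / 2)^2"
    by (simp add: norm_diff_cyl_point)
  moreover have "norm (?B - ?D) * norm (?C - ?D) = sqrt (sq_dist \<beta> \<theta> r * sq_dist \<gamma> \<theta> r)"
    by (simp flip: norm_diff_cyl_point add: real_sqrt_mult)
  ultimately show ?thesis
    unfolding cos_angle_at by (simp flip: mult_divide_mult_cancel_left[of 2 "_ \<bullet> _"])
qed

section \<open>The kernel of the derivative of the parametrization\<close>

lemma sq_dist_pos: "r > 0 \<Longrightarrow> sq_dist \<beta> \<theta> r > 0"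
  unfolding sq_dist_def by (simp add: add_nonneg_pos)

lemma DERIV_sq_dist_angle:
  "((\<lambda>t. sq_dist \<beta> t r) has_real_derivative
     4 * sin ((\<theta> - \<beta>) / 2) * cos ((\<theta> - \<beta>) / 2)) (at \<theta>)"
  unfolding sq_dist_def by (rule derivative_eq_intros refl | simp)+

lemma DERIV_sq_dist_height: "((\<lambda>s. sq_dist \<beta> \<theta> s) has_real_derivative 2 * r) (at r)"
  unfolding sq_dist_def by (rule derivative_eq_intros refl | simp)+

text \<open>The heights cancel. For the half-angles \<open>x\<close> and \<open>y\<close>,
  \<open>sin x^2 - sin y^2 = sin (x + y) * sin (x - y)\<close>, and
  \<open>sin (x + y) + sin (x - y) = 2 * sin x * cos y\<close>.\<close>

lemma sq_dist_diff:
  "sq_dist \<beta> \<theta> r - sq_dist \<gamma> \<theta> r + 4 * sin ((\<gamma> - \<beta>) / 2)^2 =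
    8 * sin ((\<theta> - \<beta>) / 2) * cos ((\<theta> - \<gamma>) / 2) * sin ((\<gamma> - \<beta>) / 2)"
proof -
  define x y where "x = (\<theta> - \<beta>) / 2" and "y = (\<theta> - \<gamma>) / 2"
  have eq: "(\<gamma> - \<beta>) / 2 = x - y" unfolding x_def y_def by (simp add: field_simps)
  have "sin x ^2 - sin y^2 + (sin x * cos y - cos x * sin y)^2
    = 2 * sin x * cos y * (sin x * cos y - cos x * sin y)"
    using sin_cos_squared_add[of x] sin_cos_squared_add[of y] by algebra
  then show ?thesis
    unfolding sq_dist_def eq sin_diff x_def[symmetric] y_def[symmetric] by simp
qed

text \<open>\<open>ker\<close> says that one component of the derivative annihilates the tangent
  vector \<open>(t, \<rho>)\<close>. By \<open>sq_dist_diff\<close> its numerator has the factor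
  \<open>sin ((\<gamma> - \<beta>) / 2)\<close>; cancelling this and dividing by
  \<open>f * g\<close> separates the two vertices.\<close>

lemma kernel_pair_relation:
  fixes \<beta> \<gamma> \<theta> r t \<rho> :: real
  defines "f \<equiv> sq_dist \<beta> \<theta> r" and "g \<equiv> sq_dist \<gamma> \<theta> r" and "K \<equiv> 4 * sin ((\<gamma> - \<beta>) / 2)^2"
    and "sb \<equiv> sin ((\<theta> - \<beta>) / 2)" and "cb \<equiv> cos ((\<theta> - \<beta>) / 2)"
    and "sc \<equiv> sin ((\<theta> - \<gamma>) / 2)" and "cc \<equiv> cos ((\<theta> - \<gamma>) / 2)"
  assumes r: "r > 0" and ne: "sin ((\<gamma> - \<beta>) / 2) \<noteq> 0"
    and ker: "t * ((4 * sb * cb * g * (f - g + K) + 4 * sc * cc * f * (g - f + K)) / (4 * sqrt (f * g)^3))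
      + \<rho> * ((2 * r * g * (f - g + K) + 2 * r * f * (g - f + K)) / (4 * sqrt (f * g)^3)) = 0"
  shows "sb * (2 * sb * cb * t + r * \<rho>) / f * cc = sc * (2 * sc * cc * t + r * \<rho>) / g * cb"
proof -
  have pos: "f > 0" "g > 0" unfolding f_def g_def using sq_dist_pos[OF r] by auto
  then have S: "4 * sqrt (f * g)^3 \<noteq> 0" by simp
  define L where "L = sin ((\<gamma> - \<beta>) / 2)"
  have d1: "f - g + K = 8 * sb * cc * L"
    unfolding f_def g_def K_def sb_def cc_def L_def by (rule sq_dist_diff)
  \<comment> \<open>Exchanging \<beta> and \<gamma> reverses the sign of \<open>L\<close> but keeps
    \<open>K\<close>.\<close>
  have "sin ((\<beta> - \<gamma>) / 2) = - L"
    unfolding L_def by (simp flip: sin_minus add: minus_divide_left)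
  then have d2: "g - f + K = - 8 * sc * cb * L"
    using sq_dist_diff[of \<gamma> \<theta> r \<beta>]
    unfolding f_def g_def K_def sc_def cb_def L_def by simp
  have "(t * (4 * sb * cb * g * (f - g + K) + 4 * sc * cc * f * (g - f + K))
      + \<rho> * (2 * r * g * (f - g + K) + 2 * r * f * (g - f + K))) / (4 * sqrt (f * g)^3) = 0"
    using ker unfolding add_divide_distrib[of "t * _" "\<rho> * _"] by (simp only: times_divide_eq_right)
  then have "t * (4 * sb * cb * g * (f - g + K) + 4 * sc * cc * f * (g - f + K))
      + \<rho> * (2 * r * g * (f - g + K) + 2 * r * f * (g - f + K)) = 0"
    using S by simp
  then have "16 * L * (sb * (2 * sb * cb * t + r * \<rho>) * cc * g - sc * (2 * sc * cc * t + r * \<rho>) * cb * f) = 0"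
    unfolding d1 d2 by (simp add: algebra_simps)
  then have "sb * (2 * sb * cb * t + r * \<rho>) * cc * g = sc * (2 * sc * cc * t + r * \<rho>) * cb * f"
    using ne unfolding L_def by simp
  then show ?thesis using pos by (simp add: field_simps)
qed

lemma FC_param_regular:
  assumes r: "r > 0"
    and ab: "sin ((\<beta> - \<alpha>) / 2) \<noteq> 0" and ac: "sin ((\<gamma> - \<alpha>) / 2) \<noteq> 0" and bc: "sin ((\<gamma> - \<beta>) / 2) \<noteq> 0"
    and sum: "cos ((3 * \<theta> - (\<alpha> + \<beta> + \<gamma>)) / 2) \<noteq> 0"
  shows "regular_param_at (FC_param (cyl_point \<alpha> 0) (cyl_point \<beta> 0) (cyl_point \<gamma> 0)) \<theta> r"
proof -
  define q where "q = (\<lambda>\<beta> \<gamma> \<theta> r. (sq_dist \<beta> \<theta> r + sq_dist \<gamma> \<theta> r - 4 * sin ((\<gamma> - \<beta>) / 2)^2)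
      / (2 * sqrt (sq_dist \<beta> \<theta> r * sq_dist \<gamma> \<theta> r)))"
  let ?X = "FC_param (cyl_point \<alpha> 0) (cyl_point \<beta> 0) (cyl_point \<gamma> 0)"
  have X: "?X t s = vector [q \<beta> \<gamma> t s, q \<alpha> \<gamma> t s, q \<alpha> \<beta> t s]" if "s > 0" for t s
    unfolding FC_param_def F_def q_def using that by (simp add: cos_angle_at_cyl_point)
  \<comment> \<open>\<open>p\<close> and \<open>p'\<close> stand for the derivatives of the two
    squared distances, so that one formula serves both partial derivatives.\<close>
  define D where "D = (\<lambda>\<beta> \<gamma> p p'. (p * sq_dist \<gamma> \<theta> r * (sq_dist \<beta> \<theta> r - sq_dist \<gamma> \<theta> r + 4 * sin ((\<gamma> - \<beta>) / 2)^2)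
    + p' * sq_dist \<beta> \<theta> r * (sq_dist \<gamma> \<theta> r - sq_dist \<beta> \<theta> r + 4 * sin ((\<gamma> - \<beta>) / 2)^2))
      / (4 * sqrt (sq_dist \<beta> \<theta> r * sq_dist \<gamma> \<theta> r)^3))"
  define p where "p = (\<lambda>\<beta>. 4 * sin ((\<theta> - \<beta>) / 2) * cos ((\<theta> - \<beta>) / 2))"
  have dt: "((\<lambda>t. q x y t r) has_real_derivative D x y (p x) (p y)) (at \<theta>)" for x y
    unfolding q_def D_def p_def
    by (rule DERIV_cosine_rule_quotient DERIV_sq_dist_angle sq_dist_pos r)+
  have ds: "((\<lambda>s. q x y \<theta> s) has_real_derivative D x y (2 * r) (2 * r)) (at r)" for x y
    unfolding q_def D_def
    by (rule DERIV_cosine_rule_quotient DERIV_sq_dist_height sq_dist_pos r)+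
  define u :: "real^3" where "u = vector [D \<beta> \<gamma> (p \<beta>) (p \<gamma>), D \<alpha> \<gamma> (p \<alpha>) (p \<gamma>), D \<alpha> \<beta> (p \<alpha>) (p \<beta>)]"
  define v :: "real^3" where "v = vector [D \<beta> \<gamma> (2 * r) (2 * r), D \<alpha> \<gamma> (2 * r) (2 * r), D \<alpha> \<beta> (2 * r) (2 * r)]"
  have u: "((\<lambda>t. ?X t r) has_vector_derivative u) (at \<theta>)"
    unfolding X[OF r] u_def by (rule has_vector_derivative_vector_3 dt)+
  have "((\<lambda>s. vector [q \<beta> \<gamma> \<theta> s, q \<alpha> \<gamma> \<theta> s, q \<alpha> \<beta> \<theta> s]) has_vector_derivative v) (at r)"
    unfolding v_def by (rule has_vector_derivative_vector_3 ds)+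
  then have v: "((\<lambda>s. ?X \<theta> s) has_vector_derivative v) (at r)"
    \<comment> \<open>The formula \<open>X\<close> is available only at positive height, hence the
      transfer on an open half-line.\<close>
    by (rule has_vector_derivative_transform_within_open[where S = "{0<..}"]) (use r X in auto)
  have "t = 0 \<and> \<rho> = 0" if comb: "t *\<^sub>R u + \<rho> *\<^sub>R v = 0" for t \<rho>
  proof -
    define s where "s = (\<lambda>\<beta>. sin ((\<theta> - \<beta>) / 2))"
    define c where "c = (\<lambda>\<beta>. cos ((\<theta> - \<beta>) / 2))"
    define M where "M = (\<lambda>\<beta>. s \<beta> * (2 * s \<beta> * c \<beta> * t + r * \<rho>) / sq_dist \<beta> \<theta> r)"
    have D0: "t * D \<beta> \<gamma> (p \<beta>) (p \<gamma>) + \<rho> * D \<beta> \<gamma> (2 * r) (2 * r) = 0"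
      "t * D \<alpha> \<gamma> (p \<alpha>) (p \<gamma>) + \<rho> * D \<alpha> \<gamma> (2 * r) (2 * r) = 0"
      "t * D \<alpha> \<beta> (p \<alpha>) (p \<beta>) + \<rho> * D \<alpha> \<beta> (2 * r) (2 * r) = 0"
      using comb unfolding u_def v_def by (simp_all add: vec_eq_iff forall_3)
    have M: "M x * c y = M y * c x"
      if "sin ((y - x) / 2) \<noteq> 0" "t * D x y (p x) (p y) + \<rho> * D x y (2 * r) (2 * r) = 0" for x y
      unfolding M_def s_def c_def
      by (rule kernel_pair_relation[OF r that(1)]) (use that(2) in \<open>simp add: D_def p_def\<close>)
    note M3 = M[OF bc D0(1)] M[OF ac D0(2)] M[OF ab D0(3)]
    have sd: "s x * c y - c x * s y = sin ((y - x) / 2)" for x y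
    proof -
      have "(y - x) / 2 = (\<theta> - x) / 2 - (\<theta> - y) / 2" by (simp add: field_simps)
      then show ?thesis unfolding s_def c_def by (simp only: sin_diff)
    qed
    \<comment> \<open>By \<open>sd\<close> at most one of the three cosines vanishes, so
      \<open>k\<close> can be read off at a vertex where the cosine is nonzero; \<open>M3\<close>
      gives the other two equations.\<close>
    obtain k where k: "M \<alpha> = k * c \<alpha>" "M \<beta> = k * c \<beta>" "M \<gamma> = k * c \<gamma>"
    proof (cases "c \<alpha> = 0")
      case True
      then have "c \<beta> \<noteq> 0" using sd[of \<alpha> \<beta>] ab by auto
      then show thesis using M3 by (intro that[of "M \<beta> / c \<beta>"]) (simp_all add: field_simps)
    next
      case False
      then show thesis using M3 by (intro that[of "M \<alpha> / c \<alpha>"]) (simp_all add: field_simps)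
    qed
    \<comment> \<open>Clearing the denominator and multiplying the terms of degree 1 by
      \<open>s x^2 + c x^2 = 1\<close> makes the equation homogeneous of degree 3.\<close>
    have cubic: "s x * (s x^2 + c x^2) * (r * \<rho>) + s x^2 * c x * (2 * t - 4 * k - k * r^2) + c x^3 * (- k * r^2) = 0"
      if "M x = k * c x" for x
    proof -
      have "s x * (2 * s x * c x * t + r * \<rho>) = k * c x * sq_dist x \<theta> r"
        using that sq_dist_pos[OF r, of x \<theta>] unfolding M_def by (simp add: field_simps)
      moreover have "sq_dist x \<theta> r = 4 * s x^2 + r^2" unfolding sq_dist_def s_def by simp
      moreover have "s x^2 + c x^2 = 1" unfolding s_def c_def by simp
      ultimately show ?thesis by algebra
    qed
    have "(3 * \<theta> - (\<alpha> + \<beta> + \<gamma>)) / 2 = (\<theta> - \<alpha>) / 2 + (\<theta> - \<beta>) / 2 + (\<theta> - \<gamma>) / 2"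
      by (simp add: field_simps)
    then have "cos ((\<theta> - \<alpha>) / 2 + (\<theta> - \<beta>) / 2 + (\<theta> - \<gamma>) / 2) \<noteq> 0"
      using sum by (simp only: not_False_eq_True)
    then have "c \<alpha> * c \<beta> * c \<gamma> - s \<alpha> * s \<beta> * c \<gamma> - s \<alpha> * c \<beta> * s \<gamma> - c \<alpha> * s \<beta> * s \<gamma> \<noteq> 0"
      unfolding cos_add sin_add s_def c_def by (simp add: algebra_simps)
    then have "r * \<rho> = 0 \<and> 2 * t - 4 * k - k * r^2 = 0 \<and> - k * r^2 = 0"
      by (intro cubic_form_zero[OF cubic[OF k(1)] cubic[OF k(2)] cubic[OF k(3)]])
        (use ab ac bc in \<open>simp_all add: sd\<close>)
    \<comment> \<open>As \<open>r > 0\<close>, the last coefficient gives \<open>k = 0\<close>, then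
      the middle one \<open>t = 0\<close>; the first gives \<open>\<rho> = 0\<close>.\<close>
    then show ?thesis using r by auto
  qed
  then have "u \<noteq> v \<and> independent {u, v}" by (rule independent_pairI)
  with u v show ?thesis unfolding regular_param_at_def by blast
qed

section \<open>Angles of the vertices and the exceptional angles\<close>

lemma unit_circle_eq_cyl_point:
  assumes "P \<in> unit_circle"
  obtains \<beta> where "P = cyl_point \<beta> 0"
proof -
  have 3: "P $ 3 = 0" and "norm P = 1"
    using assms unfolding unit_circle_def Pi_zero_def by simp_all
  then have "P \<bullet> P = 1" by (simp add: norm_eq_1)
  with 3 have "(P $ 1)^2 + (P $ 2)^2 = 1"
    by (simp add: inner_vec_def sum_3 power2_eq_square)
  then obtain \<beta> where "P $ 1 = cos \<beta>" "P $ 2 = sin \<beta>"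
    using sincos_total_2pi by metis
  with 3 have "P = cyl_point \<beta> 0" by (simp add: cyl_point_def vec_eq_iff forall_3)
  then show thesis by (rule that)
qed

lemma sin_half_diff_nonzero:
  assumes "cyl_point x 0 \<noteq> cyl_point y 0"
  shows "sin ((y - x) / 2) \<noteq> 0"
proof
  assume "sin ((y - x) / 2) = 0"
  then have "norm (cyl_point x 0 - cyl_point y 0)^2 = 0"
    unfolding norm_diff_cyl_point sq_dist_def by simp
  with assms show False by simp
qed

text \<open>The cosine vanishes iff \<open>3 * \<theta>\<close> is congruent to
  \<open>\<sigma> + pi\<close> modulo \<open>2 * pi\<close>, and \<open>3 * \<theta>\<close> runs
  through three periods on the given interval.\<close>

lemma three_exceptional_angles:
  fixes \<sigma> :: real
  obtains \<theta>1 \<theta>2 \<theta>3 where "\<theta>1 \<in> {0..<2 * pi}" "\<theta>2 \<in> {0..<2 * pi}" "\<theta>3 \<in> {0..<2 * pi}"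
    "\<theta>1 \<noteq> \<theta>2" "\<theta>1 \<noteq> \<theta>3" "\<theta>2 \<noteq> \<theta>3"
    "\<And>\<theta>. \<theta> \<in> {0..<2 * pi} - {\<theta>1, \<theta>2, \<theta>3} \<Longrightarrow> cos ((3 * \<theta> - \<sigma>) / 2) \<noteq> 0"
proof -
  \<comment> \<open>\<phi> is the representative of \<open>\<sigma> + pi\<close> in
    \<open>{0..<2 * pi}\<close>.\<close>
  define n where "n = \<lfloor>(\<sigma> + pi) / (2 * pi)\<rfloor>"
  define \<phi> where "\<phi> = \<sigma> + pi - 2 * pi * n"
  have "of_int n \<le> (\<sigma> + pi) / (2 * pi)" "(\<sigma> + pi) / (2 * pi) < of_int n + 1"
    unfolding n_def by linarith+
  then have \<phi>: "0 \<le> \<phi>" "\<phi> < 2 * pi"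
    unfolding \<phi>_def by (simp_all add: field_simps)
  have "cos ((3 * \<theta> - \<sigma>) / 2) \<noteq> 0"
    if \<theta>: "\<theta> \<in> {0..<2 * pi} - {\<phi> / 3, (\<phi> + 2 * pi) / 3, (\<phi> + 4 * pi) / 3}" for \<theta>
  proof
    assume "cos ((3 * \<theta> - \<sigma>) / 2) = 0"
    then obtain m :: int where "(3 * \<theta> - \<sigma>) / 2 = of_int m * pi + pi / 2"
      unfolding cos_zero_iff_int2 by blast
    then have "3 * \<theta> - \<sigma> = pi + 2 * pi * of_int m"
      by (simp add: field_simps)
    then have "3 * \<theta> = \<phi> + 2 * pi * of_int (n + m)"
      unfolding \<phi>_def by (simp add: algebra_simps)
    then obtain j :: int where eq: "3 * \<theta> = \<phi> + 2 * pi * of_int j" by blast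
    \<comment> \<open>\<open>3 * \<theta>\<close> is in \<open>{0..<6 * pi}\<close> and \<phi> in
      \<open>{0..<2 * pi}\<close>, so their difference lies strictly between \<open>-2 * pi\<close>
      and \<open>6 * pi\<close>.\<close>
    with \<theta> \<phi> have "2 * pi * (-1) < 2 * pi * of_int j" "2 * pi * of_int j < 2 * pi * 3"
      unfolding atLeastLessThan_iff Diff_iff by linarith+
    then have "-1 < real_of_int j" "real_of_int j < 3"
      by (simp_all only: mult_less_cancel_left_pos pi_gt_zero zero_less_mult_iff zero_less_numeral simp_thms)
    then have "j = 0 \<or> j = 1 \<or> j = 2" by linarith
    then show False using eq \<theta> by auto
  qed
  then show thesis using \<phi> by (intro that[of "\<phi> / 3" "(\<phi> + 2 * pi) / 3" "(\<phi> + 4 * pi) / 3"]) auto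
qed

theorem proposition16:
  fixes A B C :: "real^3"
  assumes "A = vector [1, 0, 0]"
    and "A \<in> unit_circle" and "B \<in> unit_circle" and "C \<in> unit_circle"
    and "\<not> collinear {A, B, C}"
  shows "\<exists>\<theta>1 \<in> {0..<2 * pi}. \<exists>\<theta>2 \<in> {0..<2 * pi}. \<exists>\<theta>3 \<in> {0..<2 * pi}.
    \<theta>1 \<noteq> \<theta>2 \<and> \<theta>1 \<noteq> \<theta>3 \<and> \<theta>2 \<noteq> \<theta>3 \<and>
    (\<forall>D \<in> M_reg \<theta>1 \<theta>2 \<theta>3. FC_smooth_at A B C D)"
proof -
  obtain \<alpha> \<beta> \<gamma> where ABC: "A = cyl_point \<alpha> 0" "B = cyl_point \<beta> 0" "C = cyl_point \<gamma> 0"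
    using assms(2-4) by (metis unit_circle_eq_cyl_point)
  \<comment> \<open>Two coinciding vertices would leave at most two points, which are
    collinear.\<close>
  have "A \<noteq> B" "A \<noteq> C" "B \<noteq> C"
    using assms(5) by (auto simp: insert_commute)
  then have sin: "sin ((\<beta> - \<alpha>) / 2) \<noteq> 0" "sin ((\<gamma> - \<alpha>) / 2) \<noteq> 0" "sin ((\<gamma> - \<beta>) / 2) \<noteq> 0"
    unfolding ABC by (simp_all add: sin_half_diff_nonzero)
  obtain \<theta>1 \<theta>2 \<theta>3 where \<theta>: "\<theta>1 \<in> {0..<2 * pi}" "\<theta>2 \<in> {0..<2 * pi}" "\<theta>3 \<in> {0..<2 * pi}"
    "\<theta>1 \<noteq> \<theta>2" "\<theta>1 \<noteq> \<theta>3" "\<theta>2 \<noteq> \<theta>3"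
    and cos: "\<And>\<theta>. \<theta> \<in> {0..<2 * pi} - {\<theta>1, \<theta>2, \<theta>3} \<Longrightarrow> cos ((3 * \<theta> - (\<alpha> + \<beta> + \<gamma>)) / 2) \<noteq> 0"
    by (rule three_exceptional_angles[of "\<alpha> + \<beta> + \<gamma>"]) blast
  have "FC_smooth_at A B C D" if DM: "D \<in> M_reg \<theta>1 \<theta>2 \<theta>3" for D
  proof -
    obtain \<theta> r where D: "D = cyl_point \<theta> r" "r > 0" and ne: "\<theta> \<in> {0..<2 * pi} - {\<theta>1, \<theta>2, \<theta>3}"
      using DM unfolding M_reg_def by auto
    have "D \<in> Cyl \<inter> Pi_plus"
      using D by (simp add: Cyl_def Pi_plus_def unit_circle_def Pi_zero_def cyl_point_def
          norm_eq_sqrt_inner inner_vec_def sum_3 flip: power2_eq_square)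
    moreover have "regular_param_at (FC_param A B C) \<theta>' r'" if D': "D = cyl_point \<theta>' r'" for \<theta>' r'
    proof -
      have eq: "cos \<theta>' = cos \<theta>" "sin \<theta>' = sin \<theta>" "r' = r"
        using D' unfolding D(1) by (simp_all add: cyl_point_def vec_eq_iff forall_3)
      then obtain m where m: "\<theta>' = \<theta> + 2 * pi * of_int m"
        using sin_cos_eq_iff[of \<theta>' \<theta>] by (auto simp: algebra_simps)
      \<comment> \<open>Smoothness concerns every parameter of \<open>D\<close>. A shift of \<theta>
        by \<open>2 * pi * m\<close> moves the argument by \<open>3 * m * pi\<close>, where the sine
        is zero and the cosine is not, so the cosine stays nonzero.\<close>
      have "(3 * \<theta>' - (\<alpha> + \<beta> + \<gamma>)) / 2 = (3 * \<theta> - (\<alpha> + \<beta> + \<gamma>)) / 2 + of_int (3 * m) * pi"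
        unfolding m by (simp add: field_simps)
      moreover have "sin (of_int (3 * m) * pi) = 0"
        unfolding sin_zero_iff_int2 by blast
      moreover from this have "cos (of_int (3 * m) * pi) \<noteq> 0"
        by (metis sin_cos_squared_add2 power_zero_numeral add_0 zero_neq_one mult_zero_left power2_eq_square)
      ultimately have "cos ((3 * \<theta>' - (\<alpha> + \<beta> + \<gamma>)) / 2) \<noteq> 0"
        using cos[OF ne] by (simp only: cos_add) simp
      with D(2) eq(3) sin show ?thesis
        unfolding ABC by (intro FC_param_regular) auto
    qed
    ultimately show ?thesis unfolding FC_smooth_at_def by blast
  qed
  with \<theta> show ?thesis by blast
qed

end
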